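(* Let $\Omega$, $\mathbb{K}$, $g$, the payoffs $v_T$ ($T>0$) and $w_\lambda$ ($\lambda>0$), the set $\mathfrak{C}$ and the set $\mathfrak{U}$ be as in the context. Let $\mathfrak{S}$ be a set (of strategies), let a game value map $V_s\colon\mathfrak{C}\to\mathfrak{U}$ be given for each $s\in\mathfrak{S}$, and let the game value map $V_{\mathrm{best}}\colon\mathfrak{C}\to\mathfrak{U}$ be defined by $$V_{\mathrm{best}}[c](\omega)=\sup_{s\in\mathfrak{S}}V_s[c](\omega)\qquad\forall c\in\mathfrak{C},\ \omega\in\Omega .$$ Let a strategy $s_*\in\mathfrak{S}$ be given. Assume that the payoffs $v_T$ $(T>0)$ and the payoffs $w_\lambda$ $(\lambda>0)$ both enjoy the weak Dynamic Programming Principle with respect to $V_{s_*}$ and with respect to $V_{\mathrm{best}}$. Then the following three conditions are equivalent: $(v)$ the strategy $s_*$ is uniformly optimal for the payoff family $v_T$ $(T>0)$ and, in addition, the functions $V_{\mathrm{best}}[v_T]$ converge uniformly on $\Omega$ as $T\uparrow\infty$; $(w)$ the strategy $s_*$ is uniformly optimal for the payoff family $w_\lambda$ $(\lambda>0)$ and, in addition, the functions $V_{\mathrm{best}}[w_\lambda]$ converge uniformly on $\Omega$ as $\lambda\downarrow0$; $(eq)$ all four limits $$\lim_{T\uparrow\infty}V_{\mathrm{best}}[v_T](\omega),\quad \lim_{\lambda\downarrow0}V_{\mathrm{best}}[w_\lambda](\omega),\quad \lim_{T\uparrow\infty}V_{s_*}[v_T](\omega),\quad \lim_{\lambda\downarrow0}V_{s_*}[w_\lambda](\omega)$$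 exist, are uniform in $\omega\in\Omega$, and coincide.
   Context: **Dynamic system.** $\Omega$ is a nonempty set, $\mathbb{K}$ is a nonempty set of maps from $[0,\infty)$ to $\Omega$ (processes), and $g\colon\Omega\to[0,1]$ is a function (running cost) such that for each $z\in\mathbb{K}$ the map $t\mapsto g(z(t))$ is Borel measurable. For real $T,\lambda>0$ and $z\in\mathbb{K}$ put $$v_T(z)=\frac1T\int_0^T g(z(t))\,dt,\qquad w_\lambda(z)=\lambda\int_0^\infty e^{-\lambda t}g(z(t))\,dt .$$ **Payoffs and game value maps.** $\mathfrak{U}$ is the set of all bounded maps from $\Omega$ to $\mathbb{R}$. $\mathfrak{C}$ is a nonempty set of maps from $\mathbb{K}$ to $\mathbb{R}$ such that $Ac+B\in\mathfrak{C}$ whenever $c\in\mathfrak{C}$, $A\ge0$, $B\in\mathbb{R}$, and such that $v_T,w_\lambda\in\mathfrak{C}$ for all $T,\lambda>0$. A map $V\colon\mathfrak{C}\to\mathfrak{U}$ is called a *game value map* if - $V[Ac+B]=A\,V[c]+B$ for all $c\in\mathfrak{C}$, $A\ge0$, $B\in\mathbb{R}$; and - for $c_1,c_2\in\mathfrak{C}$, if $c_1(z)\le c_2(z)$ for all $z\in\mathbb{K}$, then $V[c_1](\omega)\le V[c_2](\omega)$ for all $\omega\in\Omega$. It is part of the setting that $V_{\mathrm{best}}$ is a game value map (in particular, $V_{\mathrm{best}}[c]\in\mathfrak{U}$ for every $c\in\mathfrak{C}$). **Weak Dynamic Programming Principle.** Given a game value map $V$ and $T,\lambda,h>0$, define maps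 $\zeta_{h,T},\xi_{h,\lambda}\colon\mathbb{K}\to\mathbb{R}$ (depending on $V$) by $$\zeta_{h,T}(z)=\frac{1}{T+h}\int_0^h g(z(t))\,dt+\frac{T}{T+h}\,V[v_T](z(h)),$$ $$\xi_{h,\lambda}(z)=\lambda\int_0^h e^{-\lambda t}g(z(t))\,dt+e^{-\lambda h}\,V[w_\lambda](z(h)).$$ - The payoffs $v_T$ $(T>0)$ enjoy the weak Dynamic Programming Principle with respect to $V$ if $\zeta_{h,T}\in\mathfrak{C}$ for all $h,T\in\mathbb{N}$ and for every $\varepsilon>0$ there is a natural $N$ such that $|V[v_{T+h}](\omega)-V[\zeta_{h,T}](\omega)|<\varepsilon$ for all natural $h,T>N$ and all $\omega\in\Omega$. - The payoffs $w_\lambda$ $(\lambda>0)$ enjoy the weak Dynamic Programming Principle with respect to $V$ if $\xi_{h,\lambda}\in\mathfrak{C}$ for all $\lambda>0$, $h\in\mathbb{N}$ and for every $\varepsilon>0$ there is a natural $N$ such that $|V[w_\lambda](\omega)-V[\xi_{h,\lambda}](\omega)|<\varepsilon$ for all natural $h>N$, all positive $\lambda<1/N$ and all $\omega\in\Omega$. **Uniform optimality.** A strategy $s\in\mathfrak{S}$ is uniformly optimal for the payoff family $v_T$ $(T>0)$ if $\lim_{T\uparrow\infty}\sup_{\omega\in\Omega}|V_{\mathrm{best}}[v_T](\omega)-V_s[v_T](\omega)|=0$, and uniformly optimal for the payoff family $w_\lambda$ $(\lambda>0)$ if $\lim_{\lambda\downarrow0}\sup_{\omega\in\Omega}|V_{\mathrm{best}}[w_\lambda](\omega)-V_s[w_\lambda](\omega)|=0$.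 Here $T$ and $\lambda$ in the limits range over positive reals. *)

theory Defs
  imports "HOL-Analysis.Analysis"
begin

(* Maps on a set are elements of PiE, i.e. they are undefined outside that set. Thus processes that
   agree on [0, infinity), and payoffs that agree on K, are equal.
   Exception: a map from \<Omega> to the reals is any function on the type of \<Omega>, and only its values
   on \<Omega> are ever used. *)

definition avg_payoff :: "(real \<Rightarrow> 'w) set \<Rightarrow> ('w \<Rightarrow> real) \<Rightarrow> real \<Rightarrow> (real \<Rightarrow> 'w) \<Rightarrow> real" where
  "avg_payoff K g T = (\<lambda>z\<in>K. 1 / T * (LBINT t:{0..T}. g (z t)))"

definition disc_payoff :: "(real \<Rightarrow> 'w) set \<Rightarrow> ('w \<Rightarrow> real) \<Rightarrow> real \<Rightarrow> (real \<Rightarrow> 'w) \<Rightarrow> real" where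
  "disc_payoff K g l = (\<lambda>z\<in>K. l * (LBINT t:{0..}. exp (- l * t) * g (z t)))"

locale payoff_system =
  fixes \<Omega> :: "'w set"
    and K :: "(real \<Rightarrow> 'w) set"
    and g :: "'w \<Rightarrow> real"
    and C :: "((real \<Rightarrow> 'w) \<Rightarrow> real) set"
  assumes Omega_nonempty: "\<Omega> \<noteq> {}"
    and processes_nonempty: "K \<noteq> {}"
    and processes: "K \<subseteq> {0..} \<rightarrow>\<^sub>E \<Omega>"
    and cost_range: "g \<in> \<Omega> \<rightarrow> {0..1}"
    and cost_measurable:
      "\<And>z. z \<in> K \<Longrightarrow> (\<lambda>t. g (z t)) \<in> borel_measurable (restrict_space borel {0..})"
    and payoffs_nonempty: "C \<noteq> {}"
    and payoffs: "C \<subseteq> K \<rightarrow>\<^sub>E UNIV"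
    and payoffs_affine:
      "\<And>c A B. c \<in> C \<Longrightarrow> 0 \<le> A \<Longrightarrow> (\<lambda>z\<in>K. A * c z + B) \<in> C"
    and avg_payoff_mem: "\<And>T. 0 < T \<Longrightarrow> avg_payoff K g T \<in> C"
    and disc_payoff_mem: "\<And>l. 0 < l \<Longrightarrow> disc_payoff K g l \<in> C"

definition bounded_maps :: "'w set \<Rightarrow> ('w \<Rightarrow> real) set" where
  "bounded_maps \<Omega> = {f. bounded (f ` \<Omega>)}"

definition game_value_map ::
  "'w set \<Rightarrow> (real \<Rightarrow> 'w) set \<Rightarrow> ((real \<Rightarrow> 'w) \<Rightarrow> real) set \<Rightarrow>
   (((real \<Rightarrow> 'w) \<Rightarrow> real) \<Rightarrow> 'w \<Rightarrow> real) \<Rightarrow> bool" where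
  "game_value_map \<Omega> K C V \<longleftrightarrow>
     V \<in> C \<rightarrow> bounded_maps \<Omega> \<and>
     (\<forall>c\<in>C. \<forall>A\<ge>0. \<forall>B. \<forall>\<omega>\<in>\<Omega>. V (\<lambda>z\<in>K. A * c z + B) \<omega> = A * V c \<omega> + B) \<and>
     (\<forall>c1\<in>C. \<forall>c2\<in>C. (\<forall>z\<in>K. c1 z \<le> c2 z) \<longrightarrow> (\<forall>\<omega>\<in>\<Omega>. V c1 \<omega> \<le> V c2 \<omega>))"

(* The real SUP is the supremum only for nonempty sets that are bounded above. *)
definition best_value :: "'s set \<Rightarrow> ('s \<Rightarrow> 'c \<Rightarrow> 'w \<Rightarrow> real) \<Rightarrow> 'c \<Rightarrow> 'w \<Rightarrow> real" where
  "best_value S V c \<omega> = (SUP s\<in>S. V s c \<omega>)"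

definition avg_shift ::
  "(real \<Rightarrow> 'w) set \<Rightarrow> ('w \<Rightarrow> real) \<Rightarrow> (((real \<Rightarrow> 'w) \<Rightarrow> real) \<Rightarrow> 'w \<Rightarrow> real) \<Rightarrow>
   real \<Rightarrow> real \<Rightarrow> (real \<Rightarrow> 'w) \<Rightarrow> real" where
  "avg_shift K g V h T =
     (\<lambda>z\<in>K. 1 / (T + h) * (LBINT t:{0..h}. g (z t)) + T / (T + h) * V (avg_payoff K g T) (z h))"

definition disc_shift ::
  "(real \<Rightarrow> 'w) set \<Rightarrow> ('w \<Rightarrow> real) \<Rightarrow> (((real \<Rightarrow> 'w) \<Rightarrow> real) \<Rightarrow> 'w \<Rightarrow> real) \<Rightarrow>
   real \<Rightarrow> real \<Rightarrow> (real \<Rightarrow> 'w) \<Rightarrow> real" where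
  "disc_shift K g V h l =
     (\<lambda>z\<in>K. l * (LBINT t:{0..h}. exp (- l * t) * g (z t))
            + exp (- l * h) * V (disc_payoff K g l) (z h))"

(* Natural numbers are positive in the next two definitions: the shifted payoffs are only
   considered for positive parameters, and 1 / N has to make sense. *)

definition avg_weak_dpp ::
  "'w set \<Rightarrow> (real \<Rightarrow> 'w) set \<Rightarrow> ('w \<Rightarrow> real) \<Rightarrow> ((real \<Rightarrow> 'w) \<Rightarrow> real) set \<Rightarrow>
   (((real \<Rightarrow> 'w) \<Rightarrow> real) \<Rightarrow> 'w \<Rightarrow> real) \<Rightarrow> bool" where
  "avg_weak_dpp \<Omega> K g C V \<longleftrightarrow>
     (\<forall>h T :: nat. 0 < h \<longrightarrow> 0 < T \<longrightarrow> avg_shift K g V (real h) (real T) \<in> C) \<and>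
     (\<forall>\<epsilon>>0. \<exists>N::nat. 0 < N \<and>
        (\<forall>h T :: nat. N < h \<longrightarrow> N < T \<longrightarrow> (\<forall>\<omega>\<in>\<Omega>.
           \<bar>V (avg_payoff K g (real T + real h)) \<omega> - V (avg_shift K g V (real h) (real T)) \<omega>\<bar> < \<epsilon>)))"

definition disc_weak_dpp ::
  "'w set \<Rightarrow> (real \<Rightarrow> 'w) set \<Rightarrow> ('w \<Rightarrow> real) \<Rightarrow> ((real \<Rightarrow> 'w) \<Rightarrow> real) set \<Rightarrow>
   (((real \<Rightarrow> 'w) \<Rightarrow> real) \<Rightarrow> 'w \<Rightarrow> real) \<Rightarrow> bool" where
  "disc_weak_dpp \<Omega> K g C V \<longleftrightarrow>
     (\<forall>(h::nat) l. 0 < h \<longrightarrow> 0 < l \<longrightarrow> disc_shift K g V (real h) l \<in> C) \<and>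
     (\<forall>\<epsilon>>0. \<exists>N::nat. 0 < N \<and>
        (\<forall>(h::nat) l. N < h \<longrightarrow> 0 < l \<longrightarrow> l < 1 / real N \<longrightarrow> (\<forall>\<omega>\<in>\<Omega>.
           \<bar>V (disc_payoff K g l) \<omega> - V (disc_shift K g V (real h) l) \<omega>\<bar> < \<epsilon>)))"

(* F is at_top for the limit T to infinity and at_right 0 for the limit l to 0 from above. *)
definition uniformly_optimal ::
  "'w set \<Rightarrow> 's set \<Rightarrow> ('s \<Rightarrow> 'c \<Rightarrow> 'w \<Rightarrow> real) \<Rightarrow> 's \<Rightarrow> (real \<Rightarrow> 'c) \<Rightarrow> real filter \<Rightarrow> bool" where
  "uniformly_optimal \<Omega> S V s c F \<longleftrightarrow>
     ((\<lambda>r. SUP \<omega>\<in>\<Omega>. \<bar>best_value S V (c r) \<omega> - V s (c r) \<omega>\<bar>) \<longlongrightarrow> 0) F"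

end

theory Submission
  imports Defs
begin

text \<open>
  The core is a Tauberian theorem for a single game value map \<open>V\<close>: the functions \<open>V[v\<^sub>T]\<close> converge
  uniformly iff the functions \<open>V[w\<^sub>\<lambda>]\<close> do, and then to the same limit. Monotonicity and affinity make
  \<open>V\<close> nonexpansive for the sup norm. Let \<open>n = T + h\<close>, \<open>\<lambda> = 1 / n\<close> and \<open>x = h / n\<close>. Replacing the
  weights \<open>\<lambda> * exp (- \<lambda> * t)\<close> on \<open>[0, h]\<close> and \<open>exp (- \<lambda> * h)\<close> by \<open>1 / n\<close> and \<open>1 - x\<close> costs
  \<open>O(x\<^sup>2)\<close>, so the two dynamic programming principles give
  \<open>\<parallel>V[v\<^sub>n] - V[w\<^sub>\<lambda>]\<parallel> \<le> (1 - x) * \<parallel>V[v\<^sub>T] - V[w\<^sub>\<lambda>]\<parallel> + 2 * x\<^sup>2 + o(1)\<close>.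
  If one of the two families is uniformly Cauchy, then for \<open>x\<close> close to \<open>1 / m\<close> this bounds the
  upper limit of \<open>\<parallel>V[v\<^sub>n] - V[w\<^bsub>1/n\<^esub>]\<parallel>\<close> by \<open>O(1 / m)\<close>, hence that limit is \<open>0\<close>. Real parameters reduce
  to integer ones because the payoffs depend on their parameter in a relatively Lipschitz way.
\<close>

section \<open>Means of [0,1]-valued functions with respect to densities\<close>

lemma set_integrable_mult_unit:
  fixes k f :: "real \<Rightarrow> real"
  assumes k: "set_integrable lborel A k" and A: "A \<in> sets borel"
    and f: "f \<in> borel_measurable (restrict_space borel A)"
    and range: "\<And>t. t \<in> A \<Longrightarrow> 0 \<le> f t \<and> f t \<le> 1"
  shows "set_integrable lborel A (\<lambda>t. k t * f t)"
proof (rule set_integrable_bound[OF k])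
  have "(\<lambda>t. indicator A t *\<^sub>R k t) \<in> borel_measurable lborel"
    using k unfolding set_integrable_def by (rule borel_measurable_integrable)
  moreover have "(\<lambda>t. indicator A t *\<^sub>R f t) \<in> borel_measurable lborel"
    using f A by (simp add: borel_measurable_restrict_space_iff mult.commute)
  ultimately have "(\<lambda>t. (indicator A t *\<^sub>R k t) * (indicator A t *\<^sub>R f t)) \<in> borel_measurable lborel"
    by (rule borel_measurable_times)
  moreover have "(\<lambda>t. (indicator A t *\<^sub>R k t) * (indicator A t *\<^sub>R f t)) = (\<lambda>t. indicator A t *\<^sub>R (k t * f t))"
    by (auto simp: fun_eq_iff indicator_def)
  ultimately show "set_borel_measurable lborel A (\<lambda>t. k t * f t)"
    by (simp add: set_borel_measurable_def)
  show "AE t in lborel. t \<in> A \<longrightarrow> norm (k t * f t) \<le> norm (k t)"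
    using range by (intro AE_I2) (auto simp: abs_mult intro!: mult_left_le)
qed

text \<open>Pointwise domination gives \<open>c * ?J k1 f <= ?J k2 f\<close>, hence
  \<open>?J k1 f - ?J k2 f <= (1 - c) * ?J k1 f <= 1 - c\<close>. The opposite inequality is the
  same bound for \<open>1 - f\<close>, because both masses are 1.\<close>

lemma weighted_mean_diff_le:
  fixes k1 k2 f :: "real \<Rightarrow> real"
  assumes k: "set_integrable lborel A k1" "set_integrable lborel A k2"
    and mass: "(LBINT t:A. k1 t) = 1" "(LBINT t:A. k2 t) = 1"
    and nonneg: "\<And>t. t \<in> A \<Longrightarrow> 0 \<le> k1 t" and le: "\<And>t. t \<in> A \<Longrightarrow> c * k1 t \<le> k2 t"
    and c: "c \<le> 1"
    and A: "A \<in> sets borel" and f: "f \<in> borel_measurable (restrict_space borel A)"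
    and range: "\<And>t. t \<in> A \<Longrightarrow> 0 \<le> f t \<and> f t \<le> 1"
  shows "\<bar>(LBINT t:A. k1 t * f t) - (LBINT t:A. k2 t * f t)\<bar> \<le> 1 - c"
proof -
  let ?J = "\<lambda>k f. LBINT t:A. k t * f t"
  have one_sided: "?J k1 f - ?J k2 f \<le> 1 - c"
    if f: "f \<in> borel_measurable (restrict_space borel A)"
      and range: "\<And>t. t \<in> A \<Longrightarrow> 0 \<le> f t \<and> f t \<le> 1" for f :: "real \<Rightarrow> real"
  proof -
    note [simp, intro] = set_integrable_mult_unit[OF k(1) A f range]
      set_integrable_mult_unit[OF k(2) A f range]
    have "c * ?J k1 f = (LBINT t:A. c * (k1 t * f t))"
      by simp
    also have "\<dots> \<le> ?J k2 f"
    proof (intro set_integral_mono)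
      show "c * (k1 t * f t) \<le> k2 t * f t" if "t \<in> A" for t
        using mult_right_mono[OF le[OF that], of "f t"] range[OF that] by (simp add: mult.assoc)
    qed auto
    finally have 1: "c * ?J k1 f \<le> ?J k2 f" .
    have "?J k1 f \<le> (LBINT t:A. k1 t)"
      using range nonneg k by (intro set_integral_mono) (auto intro!: mult_left_le)
    then have "(1 - c) * ?J k1 f \<le> 1 - c"
      using c mass by (intro mult_left_le) auto
    with 1 show ?thesis
      by (simp add: algebra_simps)
  qed
  have "?J k1 (\<lambda>t. 1 - f t) - ?J k2 (\<lambda>t. 1 - f t) \<le> 1 - c"
    using f range by (intro one_sided) auto
  moreover have "?J k (\<lambda>t. 1 - f t) = (LBINT t:A. k t) - ?J k f"
    if "set_integrable lborel A k" for k
    using set_integrable_mult_unit[OF that A f range] that by (simp add: right_diff_distrib)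
  ultimately show ?thesis
    using one_sided[OF f range] k mass by (simp add: abs_le_iff)
qed

lemma exponential_density:
  fixes l :: real
  assumes "0 < l"
  shows "set_integrable lborel {0..} (\<lambda>t. l * exp (- l * t))"
    and "(LBINT t:{0..}. l * exp (- l * t)) = 1"
proof -
  have hk: "((\<lambda>t::real. exp (- l * t)) has_integral 1 / l) {0..}"
    using has_integral_exp_minus_to_infinity[OF assms, of 0] by simp
  then have "(\<lambda>t::real. exp (- l * t)) absolutely_integrable_on {0..}"
    by (intro nonnegative_absolutely_integrable_1) auto
  \<comment> \<open>Borel measurability is what allows \<open>integrable_completion\<close> to pass
    from Lebesgue measure, where the gauge integral lives, to \<open>lborel\<close>.\<close>
  moreover have "(\<lambda>t. indicator {0..} t *\<^sub>R exp (- l * t)) \<in> borel_measurable lborel"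
    by measurable
  ultimately have int: "set_integrable lborel {0..} (\<lambda>t. exp (- l * t))"
    unfolding set_integrable_def by (simp add: integrable_completion)
  then show "set_integrable lborel {0..} (\<lambda>t. l * exp (- l * t))"
    by (intro set_integrable_mult_right)
  show "(LBINT t:{0..}. l * exp (- l * t)) = 1"
    using set_borel_integral_eq_integral(2)[OF int] hk assms by (simp add: integral_unique)
qed

text \<open>The density of the uniform law on [0,T] is extended by zero to the half-line, so that
  averages with different horizons are integrals over one common set, as
  \<open>weighted_mean_diff_le\<close> requires.\<close>

lemma uniform_density:
  fixes T :: real
  assumes "0 < T"
  shows "set_integrable lborel {0..} (\<lambda>t. 1 / T * indicator {0..T} t :: real)"
    and "(LBINT t:{0..}. 1 / T * indicator {0..T} t) = (1 :: real)"
proof -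
  have [simp]: "(\<lambda>t. indicator {0..} t * indicator {0..T} t :: real) = indicator {0..T}"
    by (auto simp: fun_eq_iff indicator_def)
  show "set_integrable lborel {0..} (\<lambda>t. 1 / T * indicator {0..T} t :: real)"
    by (intro set_integrable_mult_right) (simp add: set_integrable_def integrable_indicator_iff emeasure_lborel_Icc_eq)
  show "(LBINT t:{0..}. 1 / T * indicator {0..T} t) = (1 :: real)"
    using assms by (simp only: set_integral_mult_right) (simp add: set_lebesgue_integral_def)
qed

text \<open>Multiplying the right-hand side by 1 + x, which is at most exp x, already gives 1 + x^3
  >= 1.\<close>

lemma exp_minus_le_quadratic:
  fixes x :: real
  assumes "0 \<le> x"
  shows "exp (- x) \<le> 1 - x + x\<^sup>2"
proof -
  have "1 \<le> (1 + x) * (1 - x + x\<^sup>2)"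
    using assms by (simp add: algebra_simps power2_eq_square)
  also have "\<dots> \<le> exp x * (1 - x + x\<^sup>2)"
  proof (intro mult_right_mono exp_ge_add_one_self)
    have "1 - x + x\<^sup>2 = (1 - x)\<^sup>2 + x"
      by (simp add: power2_eq_square algebra_simps)
    then show "0 \<le> 1 - x + x\<^sup>2"
      using assms by (metis add_nonneg_nonneg zero_le_power2)
  qed
  finally show ?thesis
    by (simp add: exp_minus field_simps)
qed

section \<open>Payoffs as weighted means of the running cost\<close>

context payoff_system
begin

lemma cost_bounds: "z \<in> K \<Longrightarrow> t \<in> {0..} \<Longrightarrow> 0 \<le> g (z t) \<and> g (z t) \<le> 1"
  using processes cost_range by (auto simp: PiE_iff Pi_iff subset_iff)

lemma state_mem: "z \<in> K \<Longrightarrow> 0 \<le> t \<Longrightarrow> z t \<in> \<Omega>"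
  using processes by (auto simp: PiE_iff subset_iff)

lemma avg_payoff_eq:
  assumes "z \<in> K"
  shows "avg_payoff K g T z = (LBINT t:{0..}. (1 / T * indicator {0..T} t) * g (z t))"
proof -
  have "(LBINT t:{0..}. indicator {0..T} t * g (z t)) = (LBINT t:{0..T}. g (z t))"
    unfolding set_lebesgue_integral_def
    by (intro Bochner_Integration.integral_cong) (auto simp: indicator_def)
  then show ?thesis
    using assms by (simp only: avg_payoff_def restrict_apply mult.assoc set_integral_mult_right if_True)
qed

lemma disc_payoff_eq:
  assumes "z \<in> K"
  shows "disc_payoff K g l z = (LBINT t:{0..}. (l * exp (- l * t)) * g (z t))"
  using assms by (simp only: disc_payoff_def restrict_apply mult.assoc set_integral_mult_right if_True)

text \<open>Scaled by T / T', the uniform density on [0,T] lies below the one on [0,T'], so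
  \<open>weighted_mean_diff_le\<close> applies with c = T / T'.\<close>

lemma avg_payoff_diff_le:
  assumes "z \<in> K" "0 < T" "T \<le> T'"
  shows "\<bar>avg_payoff K g T z - avg_payoff K g T' z\<bar> \<le> 1 - T / T'"
  unfolding avg_payoff_eq[OF assms(1)]
  using assms uniform_density[of T] uniform_density[of T'] cost_bounds
  by (intro weighted_mean_diff_le cost_measurable) (auto simp: indicator_def)

text \<open>Scaled by l / l', the density with the larger rate l' becomes
  \<open>l * exp (- l' * t)\<close>, which lies below the density with rate l.\<close>

lemma disc_payoff_diff_le:
  assumes "z \<in> K" "0 < l" "l \<le> l'"
  shows "\<bar>disc_payoff K g l' z - disc_payoff K g l z\<bar> \<le> 1 - l / l'"
  unfolding disc_payoff_eq[OF assms(1)]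
  using assms exponential_density[of l] exponential_density[of l'] cost_bounds
  by (intro weighted_mean_diff_le cost_measurable) (auto simp: mult_right_mono)

lemma weighted_cost_range:
  assumes "z \<in> K" and k: "set_integrable lborel {0..} k" "(LBINT t:{0..}. k t) = 1"
    and "\<And>t. t \<in> {0..} \<Longrightarrow> 0 \<le> k t"
  shows "(LBINT t:{0..}. k t * g (z t)) \<in> {0..1}"
proof -
  have int: "set_integrable lborel {0..} (\<lambda>t. k t * g (z t))"
    using assms cost_bounds by (intro set_integrable_mult_unit cost_measurable) auto
  have "(LBINT t:{0..}. k t * g (z t)) \<le> (LBINT t:{0..}. k t)"
    using int k assms cost_bounds by (intro set_integral_mono) (auto intro!: mult_left_le)
  moreover have "(LBINT t:({0..}::real set). (0::real)) \<le> (LBINT t:{0..}. k t * g (z t))"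
    using int assms cost_bounds
    by (intro set_integral_mono) (auto simp: set_integrable_def)
  ultimately show ?thesis
    using k by simp
qed

lemma avg_payoff_range: "z \<in> K \<Longrightarrow> 0 < T \<Longrightarrow> avg_payoff K g T z \<in> {0..1}"
  unfolding avg_payoff_eq using uniform_density[of T] by (intro weighted_cost_range) auto

lemma disc_payoff_range: "z \<in> K \<Longrightarrow> 0 < l \<Longrightarrow> disc_payoff K g l z \<in> {0..1}"
  unfolding disc_payoff_eq using exponential_density[of l] by (intro weighted_cost_range) auto

text \<open>On [0,h] the two weights differ by \<open>1 - exp (- l * t)\<close>, which lies between
  0 and \<open>l * h\<close>. Integrating over length h and multiplying by l squares this
  bound.\<close>

lemma initial_cost_diff_le:
  assumes z: "z \<in> K" and h: "0 < h" and l: "0 < l"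
  shows "\<bar>l * (LBINT t:{0..h}. g (z t)) - l * (LBINT t:{0..h}. exp (- l * t) * g (z t))\<bar> \<le> (l * h)\<^sup>2"
proof -
  have meas: "(\<lambda>t. g (z t)) \<in> borel_measurable (restrict_space borel {0..h})"
    by (rule measurable_restrict_mono[OF cost_measurable[OF z]]) auto
  have const: "set_integrable lborel {0..h} (\<lambda>t. c)" for c :: real
    by (rule borel_integrable_compact[of "{0..h}" "\<lambda>_. c", folded real_scaleR_def,
          folded set_integrable_def]) auto
  have kernel: "set_integrable lborel {0..h} (\<lambda>t. exp (- l * t))"
    unfolding set_integrable_def by (rule borel_integrable_compact) (auto intro!: continuous_intros)
  have range: "0 \<le> g (z t) \<and> g (z t) \<le> 1" if "t \<in> {0..h}" for t
    using cost_bounds[OF z] that by auto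
  have int1: "set_integrable lborel {0..h} (\<lambda>t. 1 * g (z t))"
    by (intro set_integrable_mult_unit const meas range) auto
  have int2: "set_integrable lborel {0..h} (\<lambda>t. exp (- l * t) * g (z t))"
    by (intro set_integrable_mult_unit kernel meas range) auto
  have diff: "(LBINT t:{0..h}. 1 * g (z t)) - (LBINT t:{0..h}. exp (- l * t) * g (z t))
      = (LBINT t:{0..h}. 1 * g (z t) - exp (- l * t) * g (z t))"
    using int1 int2 by (rule set_integral_diff(2)[symmetric])
  have pointwise: "0 \<le> 1 * g (z t) - exp (- l * t) * g (z t)"
    "1 * g (z t) - exp (- l * t) * g (z t) \<le> l * h" if t: "t \<in> {0..h}" for t
  proof -
    have "1 - l * t \<le> exp (- l * t)" "l * t \<le> l * h"
      using t l exp_ge_add_one_self[of "- l * t"] by auto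
    then have exp: "0 \<le> 1 - exp (- l * t)" "1 - exp (- l * t) \<le> l * h"
      using t l by (simp, linarith)
    have eq: "1 * g (z t) - exp (- l * t) * g (z t) = (1 - exp (- l * t)) * g (z t)"
      by (simp add: algebra_simps)
    show "0 \<le> 1 * g (z t) - exp (- l * t) * g (z t)"
      unfolding eq using exp range[OF t] by (intro mult_nonneg_nonneg) auto
    show "1 * g (z t) - exp (- l * t) * g (z t) \<le> l * h"
      unfolding eq using exp range[OF t] mult_left_le[of "g (z t)" "1 - exp (- l * t)"] by linarith
  qed
  have "(LBINT t:{0..h}. 0) \<le> (LBINT t:{0..h}. 1 * g (z t) - exp (- l * t) * g (z t))"
    using int1 int2 pointwise(1) const by (intro set_integral_mono set_integral_diff(1)) auto
  moreover have "(LBINT t:{0..h}. 1 * g (z t) - exp (- l * t) * g (z t)) \<le> (LBINT t:{0..h}. l * h)"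
    using int1 int2 pointwise(2) const by (intro set_integral_mono set_integral_diff(1)) auto
  moreover have "(LBINT t:{0..h}. l * h) = l * h * h"
    using h by (simp add: set_lebesgue_integral_def)
  ultimately have "\<bar>(LBINT t:{0..h}. 1 * g (z t)) - (LBINT t:{0..h}. exp (- l * t) * g (z t))\<bar> \<le> l * h * h"
    unfolding diff set_lebesgue_integral_zero by linarith
  then have "\<bar>(LBINT t:{0..h}. g (z t)) - (LBINT t:{0..h}. exp (- l * t) * g (z t))\<bar> \<le> l * h * h"
    by simp
  then show ?thesis
    using l mult_left_mono[of _ "l * h * h" l]
    by (simp add: abs_mult right_diff_distrib[symmetric] power2_eq_square mult.assoc mult.left_commute)
qed

end

section \<open>One game value map, later taken to be \<open>V s0\<close> and
  \<open>Vbest\<close>\<close>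

locale dpp_value = payoff_system \<Omega> K g C
  for \<Omega> :: "'w set" and K g C +
  fixes V :: "((real \<Rightarrow> 'w) \<Rightarrow> real) \<Rightarrow> 'w \<Rightarrow> real"
  assumes value_map: "game_value_map \<Omega> K C V"
    and avg_dpp: "avg_weak_dpp \<Omega> K g C V"
    and disc_dpp: "disc_weak_dpp \<Omega> K g C V"
begin

lemma value_affine:
  "c \<in> C \<Longrightarrow> 0 \<le> A \<Longrightarrow> \<omega> \<in> \<Omega> \<Longrightarrow> V (\<lambda>z\<in>K. A * c z + B) \<omega> = A * V c \<omega> + B"
  using value_map by (auto simp: game_value_map_def)

lemma value_mono:
  "c \<in> C \<Longrightarrow> c' \<in> C \<Longrightarrow> (\<And>z. z \<in> K \<Longrightarrow> c z \<le> c' z) \<Longrightarrow> \<omega> \<in> \<Omega> \<Longrightarrow> V c \<omega> \<le> V c' \<omega>"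
  using value_map by (auto simp: game_value_map_def)

text \<open>By affinity with A = 1, V commutes with adding the constant r, so monotonicity is
  applied to c and the shifted c'. Used in both directions, this makes V nonexpansive.\<close>

lemma value_le_add:
  assumes "c \<in> C" "c' \<in> C" "\<And>z. z \<in> K \<Longrightarrow> c z \<le> c' z + r" "\<omega> \<in> \<Omega>"
  shows "V c \<omega> \<le> V c' \<omega> + r"
proof -
  have "V c \<omega> \<le> V (\<lambda>z\<in>K. 1 * c' z + r) \<omega>"
    using assms payoffs_affine[of c' 1 r] by (intro value_mono) auto
  then show ?thesis
    using value_affine[of c' 1 \<omega> r] assms by simp
qed

lemma value_nonexpansive:
  assumes "c \<in> C" "c' \<in> C" "\<And>z. z \<in> K \<Longrightarrow> \<bar>c z - c' z\<bar> \<le> r" "\<omega> \<in> \<Omega>"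
  shows "\<bar>V c \<omega> - V c' \<omega>\<bar> \<le> r"
proof -
  have "c z \<le> c' z + r \<and> c' z \<le> c z + r" if "z \<in> K" for z
    using assms(3)[OF that] by linarith
  then show ?thesis
    using value_le_add[of c c' r \<omega>] value_le_add[of c' c r \<omega>] assms by fastforce
qed

lemma value_range:
  assumes c: "c \<in> C" and range: "\<And>z. z \<in> K \<Longrightarrow> c z \<in> {0..1}" and \<omega>: "\<omega> \<in> \<Omega>"
  shows "V c \<omega> \<in> {0..1}"
proof -
  \<comment> \<open>Constant payoffs belong to C as degenerate affine images of c, and V fixes
    constants.\<close>
  have const: "(\<lambda>z\<in>K. 0 * c z + B) \<in> C" "V (\<lambda>z\<in>K. 0 * c z + B) \<omega> = B" for B
    using payoffs_affine[OF c, of 0 B] value_affine[OF c _ \<omega>, of 0 B] by simp_all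
  have "V (\<lambda>z\<in>K. 0 * c z + 0) \<omega> \<le> V c \<omega>" "V c \<omega> \<le> V (\<lambda>z\<in>K. 0 * c z + 1) \<omega>"
    using range by (intro value_mono const c \<omega>; simp)+
  then show ?thesis
    using const by simp
qed

definition avg_value :: "real \<Rightarrow> 'w \<Rightarrow> real" where
  "avg_value T = V (avg_payoff K g T)"

text \<open>The index is the horizon, the reciprocal of the discount rate. Both families are then
  studied at infinity and obey the same relative Lipschitz bound.\<close>

definition disc_value :: "real \<Rightarrow> 'w \<Rightarrow> real" where
  "disc_value T = V (disc_payoff K g (inverse T))"

lemma avg_value_range: "0 < T \<Longrightarrow> \<omega> \<in> \<Omega> \<Longrightarrow> avg_value T \<omega> \<in> {0..1}"
  unfolding avg_value_def by (intro value_range avg_payoff_mem avg_payoff_range)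

lemma disc_value_range: "0 < T \<Longrightarrow> \<omega> \<in> \<Omega> \<Longrightarrow> disc_value T \<omega> \<in> {0..1}"
  unfolding disc_value_def by (intro value_range disc_payoff_mem disc_payoff_range) auto

lemma avg_value_diff_le:
  "0 < T \<Longrightarrow> T \<le> T' \<Longrightarrow> \<omega> \<in> \<Omega> \<Longrightarrow> \<bar>avg_value T \<omega> - avg_value T' \<omega>\<bar> \<le> 1 - T / T'"
  unfolding avg_value_def by (intro value_nonexpansive avg_payoff_mem avg_payoff_diff_le) auto

lemma disc_value_diff_le:
  assumes "0 < T" "T \<le> T'" "\<omega> \<in> \<Omega>"
  shows "\<bar>disc_value T \<omega> - disc_value T' \<omega>\<bar> \<le> 1 - T / T'"
proof -
  have "1 - inverse T' / inverse T = 1 - T / T'"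
    by (simp add: field_simps)
  then show ?thesis
    unfolding disc_value_def
    using assms disc_payoff_diff_le[of _ "inverse T'" "inverse T"]
    by (intro value_nonexpansive disc_payoff_mem) (auto intro: le_imp_inverse_le)
qed

text \<open>With discount rate 1 / (T + h), the continuation weights are 1 - x and exp (- x). One
  x^2 comes from the cost on [0,h], the other from replacing exp (- x) by 1 - x. The horizons in B
  differ because the average has used up time h while the discount rate stays the same.\<close>

lemma shift_diff_le:
  assumes z: "z \<in> K" and T: "0 < T" and h: "0 < h"
    and B: "\<bar>avg_value T (z h) - disc_value (T + h) (z h)\<bar> \<le> B"
  defines "x \<equiv> h / (T + h)"
  shows "\<bar>avg_shift K g V h T z - disc_shift K g V h (inverse (T + h)) z\<bar> \<le> (1 - x) * B + 2 * x\<^sup>2"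
proof -
  let ?l = "inverse (T + h)" and ?a = "avg_value T (z h)" and ?d = "disc_value (T + h) (z h)"
  have x: "?l * h = x" "T / (T + h) = 1 - x" "0 \<le> x" "x \<le> 1"
    using T h by (auto simp: x_def field_simps)
  have "\<bar>?l * (LBINT t:{0..h}. g (z t)) - ?l * (LBINT t:{0..h}. exp (- ?l * t) * g (z t))\<bar> \<le> x\<^sup>2"
    using initial_cost_diff_le[OF z h, of ?l] T h x(1) by simp
  moreover have "\<bar>(1 - x) * ?a - exp (- x) * ?d\<bar> \<le> (1 - x) * B + x\<^sup>2"
  proof -
    have "\<bar>exp (- x) - (1 - x)\<bar> \<le> x\<^sup>2"
      using exp_minus_le_quadratic[of x] exp_ge_add_one_self[of "- x"] x by auto
    moreover have "?d \<in> {0..1}"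
      using disc_value_range[of "T + h" "z h"] state_mem[OF z] T h by auto
    ultimately have "\<bar>(exp (- x) - (1 - x)) * ?d\<bar> \<le> x\<^sup>2 * 1"
      unfolding abs_mult by (intro mult_mono) auto
    moreover have "\<bar>(1 - x) * (?a - ?d)\<bar> \<le> (1 - x) * B"
      unfolding abs_mult using B x by (simp add: mult_left_mono)
    moreover have "(1 - x) * ?a - exp (- x) * ?d = (1 - x) * (?a - ?d) - (exp (- x) - (1 - x)) * ?d"
      by (simp add: algebra_simps)
    ultimately show ?thesis
      by linarith
  qed
  moreover have "avg_shift K g V h T z = ?l * (LBINT t:{0..h}. g (z t)) + (1 - x) * ?a"
    using z x(2) by (simp add: avg_shift_def avg_value_def inverse_eq_divide)
  moreover have "disc_shift K g V h ?l z =
      ?l * (LBINT t:{0..h}. exp (- ?l * t) * g (z t)) + exp (- x) * ?d"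
    using z x(1) by (simp add: disc_shift_def disc_value_def)
  ultimately show ?thesis
    by linarith
qed

text \<open>Each dynamic programming principle costs one \<epsilon>; between the shifted payoffs,
  \<open>shift_diff_le\<close> is transported by nonexpansiveness of V. The threshold N depends on
  \<epsilon> only, not on B.\<close>

lemma dpp_step:
  assumes "0 < \<epsilon>"
  obtains N :: nat where "0 < N"
    "\<And>h T B \<omega>. N < h \<Longrightarrow> N < T \<Longrightarrow> \<omega> \<in> \<Omega> \<Longrightarrow>
      (\<And>\<omega>. \<omega> \<in> \<Omega> \<Longrightarrow> \<bar>avg_value (real T) \<omega> - disc_value (real (T + h)) \<omega>\<bar> \<le> B) \<Longrightarrow>
      \<bar>avg_value (real (T + h)) \<omega> - disc_value (real (T + h)) \<omega>\<bar> \<le>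
        (1 - real h / real (T + h)) * B + 2 * (real h / real (T + h))\<^sup>2 + 2 * \<epsilon>"
proof -
  obtain N1 :: nat where N1: "\<And>h T \<omega>. N1 < h \<Longrightarrow> N1 < T \<Longrightarrow> \<omega> \<in> \<Omega> \<Longrightarrow>
      \<bar>V (avg_payoff K g (real T + real h)) \<omega> - V (avg_shift K g V (real h) (real T)) \<omega>\<bar> < \<epsilon>"
    using avg_dpp assms unfolding avg_weak_dpp_def by meson
  obtain N2 :: nat where N2: "0 < N2" "\<And>h l \<omega>. N2 < h \<Longrightarrow> 0 < l \<Longrightarrow> l < 1 / real N2 \<Longrightarrow> \<omega> \<in> \<Omega> \<Longrightarrow>
      \<bar>V (disc_payoff K g l) \<omega> - V (disc_shift K g V (real h) l) \<omega>\<bar> < \<epsilon>"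
    using disc_dpp assms unfolding disc_weak_dpp_def by meson
  show thesis
  proof (rule that[of "max N1 N2"])
    show "0 < max N1 N2"
      using N2(1) by simp
    fix h T :: nat and B :: real and \<omega>
    assume hT: "max N1 N2 < h" "max N1 N2 < T" and \<omega>: "\<omega> \<in> \<Omega>"
      and B: "\<And>\<omega>. \<omega> \<in> \<Omega> \<Longrightarrow> \<bar>avg_value (real T) \<omega> - disc_value (real (T + h)) \<omega>\<bar> \<le> B"
    let ?l = "inverse (real T + real h)"
    have pos: "0 < h" "0 < T" "0 < ?l"
      using hT by (auto simp: add_pos_pos)
    have "?l < 1 / real N2"
      using hT N2(1) by (simp add: field_simps)
    then have disc: "\<bar>disc_value (real T + real h) \<omega> - V (disc_shift K g V (real h) ?l) \<omega>\<bar> < \<epsilon>"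
      unfolding disc_value_def using hT N2 \<omega> pos by auto
    have avg: "\<bar>avg_value (real T + real h) \<omega> - V (avg_shift K g V (real h) (real T)) \<omega>\<bar> < \<epsilon>"
      unfolding avg_value_def using hT N1 \<omega> by auto
    have "\<bar>V (avg_shift K g V (real h) (real T)) \<omega> - V (disc_shift K g V (real h) ?l) \<omega>\<bar>
        \<le> (1 - real h / (real T + real h)) * B + 2 * (real h / (real T + real h))\<^sup>2"
    proof (intro value_nonexpansive \<omega>)
      show "avg_shift K g V (real h) (real T) \<in> C" "disc_shift K g V (real h) ?l \<in> C"
        using avg_dpp disc_dpp pos by (simp_all add: avg_weak_dpp_def disc_weak_dpp_def)
      show "\<bar>avg_shift K g V (real h) (real T) z - disc_shift K g V (real h) ?l z\<bar>
        \<le> (1 - real h / (real T + real h)) * B + 2 * (real h / (real T + real h))\<^sup>2" if "z \<in> K" for z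
        using that pos B[of "z (real h)"] state_mem[of z "real h"] by (intro shift_diff_le) auto
    qed
    with disc avg show "\<bar>avg_value (real (T + h)) \<omega> - disc_value (real (T + h)) \<omega>\<bar> \<le>
        (1 - real h / real (T + h)) * B + 2 * (real h / real (T + h))\<^sup>2 + 2 * \<epsilon>"
      by simp
  qed
qed

end

section \<open>Iteration of eventual bounds, and reduction to integer horizons\<close>

lemma contraction_bound:
  fixes P :: "real \<Rightarrow> bool"
  assumes base: "P B0" and mono: "\<And>B B'. P B \<Longrightarrow> B \<le> B' \<Longrightarrow> P B'"
    and step: "\<And>B. 0 \<le> B \<Longrightarrow> P B \<Longrightarrow> P ((1 - q) * B + r)"
    and q: "0 < q" "q \<le> 1" and r: "0 \<le> r" and e: "r / q < e"
  shows "P e"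
proof -
  let ?D = "\<bar>B0\<bar>"
  \<comment> \<open>The map taking B to \<open>(1 - q) * B + r\<close> fixes r / q and shrinks the
    distance to it by the factor 1 - q. Starting from r / q + |B0| dominates B0 and keeps every
    iterate nonnegative, as the step hypothesis demands. Since e exceeds r / q, finitely many
    iterations suffice.\<close>
  have iterate: "P (r / q + (1 - q) ^ j * ?D)" for j
  proof (induction j)
    case 0
    show ?case
      using q r by (intro mono[OF base]) (simp add: add_increasing)
  next
    case (Suc j)
    have "P ((1 - q) * (r / q + (1 - q) ^ j * ?D) + r)"
      using q r by (intro step Suc) auto
    moreover have "(1 - q) * (r / q + (1 - q) ^ j * ?D) + r = r / q + (1 - q) ^ Suc j * ?D"
      using q by (simp add: field_simps)
    ultimately show ?case
      by simp
  qed
  have "(\<lambda>j. r / q + (1 - q) ^ j * ?D) \<longlonglongrightarrow> r / q + 0 * ?D"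
    using q by (intro tendsto_intros LIMSEQ_power_zero) auto
  then have "eventually (\<lambda>j. r / q + (1 - q) ^ j * ?D < e) sequentially"
    using e by (intro order_tendstoD(2)) auto
  then obtain j where "r / q + (1 - q) ^ j * ?D < e"
    by (auto simp: eventually_sequentially)
  then show ?thesis
    using mono[OF iterate[of j]] by simp
qed

text \<open>Rounding T down to an integer n changes F by at most 1 - n / T < 1 / T, uniformly on
  X.\<close>

lemma uniform_limit_at_top_iff_sequentially:
  fixes F :: "real \<Rightarrow> 'a \<Rightarrow> real"
  assumes diff: "\<And>T T' x. 0 < T \<Longrightarrow> T \<le> T' \<Longrightarrow> x \<in> X \<Longrightarrow> \<bar>F T x - F T' x\<bar> \<le> 1 - T / T'"
  shows "uniform_limit X F L at_top \<longleftrightarrow> uniform_limit X (\<lambda>n. F (real n)) L sequentially"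
proof (intro iffI uniform_limitI)
  assume "uniform_limit X F L at_top"
  then show "\<forall>\<^sub>F n in sequentially. \<forall>x\<in>X. dist (F (real n) x) (L x) < e" if "0 < e" for e
    using that uniform_limitD eventually_compose_filterlim[OF _ filterlim_real_sequentially] by blast
next
  fix e :: real
  assume lim: "uniform_limit X (\<lambda>n. F (real n)) L sequentially" and e: "0 < e"
  obtain N :: nat where N: "\<And>n x. N \<le> n \<Longrightarrow> x \<in> X \<Longrightarrow> dist (F (real n) x) (L x) < e / 2"
    using uniform_limitD[OF lim, of "e / 2"] e by (auto simp: eventually_sequentially)
  show "\<forall>\<^sub>F T in at_top. \<forall>x\<in>X. dist (F T x) (L x) < e"
    \<comment> \<open>The first threshold makes the floor of T positive and at least N; the second
      gives 1 / T < e / 2.\<close>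
    using eventually_gt_at_top[of "real N + 1"] eventually_gt_at_top[of "2 / e"]
  proof eventually_elim
    case (elim T)
    define n where "n = nat \<lfloor>T\<rfloor>"
    have n: "real n \<le> T" "T < real n + 1" "N \<le> n" "0 < n"
      using elim unfolding n_def by linarith+
    then have T: "0 < T"
      by linarith
    have "1 - real n / T < e / 2"
    proof -
      have "2 < T * e"
        using elim e by (simp add: field_simps)
      then show ?thesis
        using n T by (simp add: field_simps)
    qed
    moreover have "\<bar>F (real n) x - F T x\<bar> \<le> 1 - real n / T" "\<bar>F (real n) x - L x\<bar> < e / 2"
      if "x \<in> X" for x
      using diff[of "real n" T x] N[of n x] n that by (simp_all add: dist_real_def)
    ultimately show ?case
      unfolding dist_real_def by (smt (verit) field_sum_of_halves)
  qed
qed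

section \<open>The Tauberian theorem for one game value map\<close>

context dpp_value
begin

text \<open>
  For large \<open>n\<close> take \<open>h = n div m\<close>, so that \<open>h / n\<close> lies between \<open>1 / (2 * m)\<close> and \<open>1 / m\<close>:
  each step contracts the eventual bound by \<open>1 - 1 / (2 * m)\<close> up to an error \<open>3 / m\<^sup>2\<close>.
\<close>

lemma values_close:
  assumes conv: "uniformly_convergent_on \<Omega> (\<lambda>n. avg_value (real n)) \<or>
      uniformly_convergent_on \<Omega> (\<lambda>n. disc_value (real n))"
    and e: "0 < e"
  shows "\<forall>\<^sub>F n in sequentially. \<forall>\<omega>\<in>\<Omega>. \<bar>avg_value (real n) \<omega> - disc_value (real n) \<omega>\<bar> \<le> e"
proof -
  define P where "P B \<longleftrightarrow> (\<forall>\<^sub>F n in sequentially. \<forall>\<omega>\<in>\<Omega>.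
      \<bar>avg_value (real n) \<omega> - disc_value (real n) \<omega>\<bar> \<le> B)" for B
  \<comment> \<open>The limiting bound of the iteration is r / q = 6 / m, which has to be below
    e.\<close>
  obtain m :: nat where m: "max 1 (6 / e) < real m"
    using reals_Archimedean2 by blast
  define q where "q = 1 / (2 * real m)"
  define r where "r = 3 / (real m)\<^sup>2"
  \<comment> \<open>Three errors \<epsilon>, one from the Cauchy property and two from
    \<open>dpp_step\<close>, add up to 1 / m^2. Together with 2 * x^2 <= 2 / m^2 they make up
    r.\<close>
  define \<epsilon> where "\<epsilon> = 1 / (3 * (real m)\<^sup>2)"
  have m1: "1 < m" and me: "6 / real m < e" and \<epsilon>: "0 < \<epsilon>"
    using m e by (auto simp: \<epsilon>_def field_simps)
  have "P e"
  proof (rule contraction_bound[of P 1 q r])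
    have "\<bar>avg_value (real n) \<omega> - disc_value (real n) \<omega>\<bar> \<le> 1" if "0 < n" "\<omega> \<in> \<Omega>" for n \<omega>
      using avg_value_range[of "real n" \<omega>] disc_value_range[of "real n" \<omega>] that by auto
    then show "P 1"
      unfolding P_def by (intro eventually_mono[OF eventually_gt_at_top[of "0::nat"]]) auto
    show "P B'" if "P B" "B \<le> B'" for B B'
      using that unfolding P_def by (fastforce elim: eventually_mono)
    show "0 < q" "q \<le> 1" "0 \<le> r" "r / q < e"
      using m1 me by (auto simp: q_def r_def power2_eq_square)
    show "P ((1 - q) * B + r)" if B: "0 \<le> B" "P B" for B
    proof -
      obtain N0 where N0: "\<And>n \<omega>. N0 \<le> n \<Longrightarrow> \<omega> \<in> \<Omega> \<Longrightarrow>
          \<bar>avg_value (real n) \<omega> - disc_value (real n) \<omega>\<bar> \<le> B"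
        using B(2) unfolding P_def eventually_sequentially by blast
      obtain N1 where N1: "(\<forall>\<omega>\<in>\<Omega>. \<forall>n\<ge>N1. \<forall>k\<ge>N1. dist (avg_value (real n) \<omega>) (avg_value (real k) \<omega>) < \<epsilon>) \<or>
          (\<forall>\<omega>\<in>\<Omega>. \<forall>n\<ge>N1. \<forall>k\<ge>N1. dist (disc_value (real n) \<omega>) (disc_value (real k) \<omega>) < \<epsilon>)"
        using conv \<epsilon> unfolding uniformly_convergent_eq_Cauchy uniformly_Cauchy_on_def by meson
      \<comment> \<open>\<open>dpp_step\<close> compares different horizons. Whichever family is
        Cauchy is moved to the index of the other one, where the bound B is available.\<close>
      have near: "\<bar>avg_value (real T) \<omega> - disc_value (real n) \<omega>\<bar> \<le> B + \<epsilon>"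
        if le: "max N0 N1 \<le> T" "max N0 N1 \<le> n" and \<omega>: "\<omega> \<in> \<Omega>" for T n \<omega>
        using N1
      proof
        assume "\<forall>\<omega>\<in>\<Omega>. \<forall>n\<ge>N1. \<forall>k\<ge>N1. dist (avg_value (real n) \<omega>) (avg_value (real k) \<omega>) < \<epsilon>"
        then have "dist (avg_value (real T) \<omega>) (avg_value (real n) \<omega>) < \<epsilon>"
          using le \<omega> by auto
        then show ?thesis
          using N0[of n \<omega>] le \<omega> unfolding dist_real_def by simp
      next
        assume "\<forall>\<omega>\<in>\<Omega>. \<forall>n\<ge>N1. \<forall>k\<ge>N1. dist (disc_value (real n) \<omega>) (disc_value (real k) \<omega>) < \<epsilon>"
        then have "dist (disc_value (real T) \<omega>) (disc_value (real n) \<omega>) < \<epsilon>"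
          using le \<omega> by auto
        then show ?thesis
          using N0[of T \<omega>] le \<omega> unfolding dist_real_def by simp
      qed
      obtain N2 where N2: "\<And>h T B \<omega>. N2 < h \<Longrightarrow> N2 < T \<Longrightarrow> \<omega> \<in> \<Omega> \<Longrightarrow>
          (\<And>\<omega>. \<omega> \<in> \<Omega> \<Longrightarrow> \<bar>avg_value (real T) \<omega> - disc_value (real (T + h)) \<omega>\<bar> \<le> B) \<Longrightarrow>
          \<bar>avg_value (real (T + h)) \<omega> - disc_value (real (T + h)) \<omega>\<bar> \<le>
            (1 - real h / real (T + h)) * B + 2 * (real h / real (T + h))\<^sup>2 + 2 * \<epsilon>"
        using dpp_step[OF \<epsilon>] by metis
      define M where "M = max (max N0 N1) N2 + 1"
      have M: "max N0 N1 < M" "N2 < M"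
        by (auto simp: M_def max_def)
      \<comment> \<open>The bound on n makes h = n div m at least 2 * M. Since m >= 2, the remainder
        T = n - h is at least h, so both exceed all thresholds.\<close>
      have "\<bar>avg_value (real n) \<omega> - disc_value (real n) \<omega>\<bar> \<le> (1 - q) * B + r"
        if n: "2 * m * M \<le> n" and \<omega>: "\<omega> \<in> \<Omega>" for n \<omega>
      proof -
        define h where "h = n div m"
        define T where "T = n - h"
        define x where "x = real h / real n"
        have "2 * M \<le> h"
          using m1 n div_le_mono[OF n, of m] by (simp add: h_def mult.commute mult.left_commute)
        moreover have hm: "h * m \<le> n" "n < h * m + m"
          using m1 dividend_less_div_times[of m n] by (simp_all add: h_def)
        moreover have "2 * h \<le> h * m"
          using m1 by simp
        ultimately have h: "2 * M \<le> h" "2 * M \<le> T" "T + h = n" "M \<le> n"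
          unfolding T_def by linarith+
        have n0: "0 < n" and nm: "2 * m \<le> n"
          using h n m1 M(2) by (auto intro: order_trans[rotated])
        \<comment> \<open>Integer division loses less than m, hence at most n / 2. So h * m is at
          least n / 2, which is q <= x.\<close>
        have "real h * real m \<le> real n" "real n \<le> real h * real m + real m" "2 * real m \<le> real n"
          using hm nm by (simp_all flip: of_nat_mult of_nat_add)
        then have x: "x \<le> 1 / real m" "q \<le> x" "0 \<le> x"
          using n0 m1 by (auto simp: x_def q_def field_simps)
        have "N2 < h" "N2 < T" "max N0 N1 \<le> T" "max N0 N1 \<le> T + h"
          using h M by linarith+
        then have "\<bar>avg_value (real n) \<omega> - disc_value (real n) \<omega>\<bar> \<le> (1 - x) * (B + \<epsilon>) + 2 * x\<^sup>2 + 2 * \<epsilon>"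
          using N2[of h T \<omega> "B + \<epsilon>", OF _ _ \<omega> near] unfolding h(3) x_def by blast
        moreover have "(1 - x) * (B + \<epsilon>) \<le> (1 - q) * B + \<epsilon>"
        proof -
          have "(1 - x) * B \<le> (1 - q) * B" "0 \<le> x * \<epsilon>"
            using x B \<epsilon> by (auto intro: mult_right_mono)
          then show ?thesis
            by (simp add: algebra_simps)
        qed
        moreover have "x\<^sup>2 \<le> 1 / (real m)\<^sup>2"
          using power_mono[OF x(1) x(3), of 2] by (simp add: power_divide)
        moreover have "2 * (1 / (real m)\<^sup>2) + 3 * \<epsilon> = r"
          by (simp add: r_def \<epsilon>_def field_simps)
        ultimately show ?thesis
          by linarith
      qed
      then show ?thesis
        unfolding P_def eventually_sequentially by blast
    qed
  qed
  then show ?thesis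
    by (simp add: P_def)
qed

text \<open>Along the integers, convergence of either family forces the difference of the two to
  vanish uniformly by \<open>values_close\<close>, so the limit carries over. The equivalence holds
  for each fixed L, which later keeps the limits equal.\<close>

theorem uniform_limit_avg_iff_disc:
  "uniform_limit \<Omega> (\<lambda>T. V (avg_payoff K g T)) L at_top \<longleftrightarrow>
   uniform_limit \<Omega> (\<lambda>l. V (disc_payoff K g l)) L (at_right 0)"
proof -
  have avg: "uniform_limit \<Omega> avg_value L at_top \<longleftrightarrow>
      uniform_limit \<Omega> (\<lambda>n. avg_value (real n)) L sequentially"
    by (intro uniform_limit_at_top_iff_sequentially avg_value_diff_le)
  have disc: "uniform_limit \<Omega> disc_value L at_top \<longleftrightarrow>
      uniform_limit \<Omega> (\<lambda>n. disc_value (real n)) L sequentially"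
    by (intro uniform_limit_at_top_iff_sequentially disc_value_diff_le)
  have close: "uniform_limit \<Omega> (\<lambda>n \<omega>. avg_value (real n) \<omega> - disc_value (real n) \<omega>) (\<lambda>_. 0) sequentially"
    if "uniform_limit \<Omega> (\<lambda>n. avg_value (real n)) L sequentially \<or>
        uniform_limit \<Omega> (\<lambda>n. disc_value (real n)) L sequentially"
  proof (rule uniform_limitI)
    fix e :: real
    assume e: "0 < e"
    have "\<forall>\<^sub>F n in sequentially. \<forall>\<omega>\<in>\<Omega>. \<bar>avg_value (real n) \<omega> - disc_value (real n) \<omega>\<bar> \<le> e / 2"
      using that e by (intro values_close) (auto simp: uniformly_convergent_on_def)
    then show "\<forall>\<^sub>F n in sequentially. \<forall>\<omega>\<in>\<Omega>. dist (avg_value (real n) \<omega> - disc_value (real n) \<omega>) 0 < e"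
      by (rule eventually_mono) (use e in fastforce)
  qed
  have "uniform_limit \<Omega> (\<lambda>n. avg_value (real n)) L sequentially \<longleftrightarrow>
      uniform_limit \<Omega> (\<lambda>n. disc_value (real n)) L sequentially"
  proof
    assume lim: "uniform_limit \<Omega> (\<lambda>n. avg_value (real n)) L sequentially"
    then show "uniform_limit \<Omega> (\<lambda>n. disc_value (real n)) L sequentially"
      using uniform_limit_minus[OF lim close] by simp
  next
    assume lim: "uniform_limit \<Omega> (\<lambda>n. disc_value (real n)) L sequentially"
    then show "uniform_limit \<Omega> (\<lambda>n. avg_value (real n)) L sequentially"
      using uniform_limit_add[OF lim close] by simp
  qed
  then show ?thesis
    \<comment> \<open>As \<open>uniform_limit\<close> is a \<open>filterlim\<close>, substituting
      the inverse of the discount rate turns the limit at 0 from the right into a limit of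
      \<open>disc_value\<close> at infinity.\<close>
    using avg disc
    by (simp add: filterlim_at_right_to_top avg_value_def[abs_def] disc_value_def[abs_def])
qed

end

section \<open>Uniform optimality and the three equivalent conditions\<close>

lemma uniformly_optimal_iff:
  assumes ne: "\<Omega> \<noteq> {}"
    and bdd: "\<forall>\<^sub>F r in F. bdd_above ((\<lambda>\<omega>. \<bar>best_value S V (c r) \<omega> - V s (c r) \<omega>\<bar>) ` \<Omega>)"
  shows "uniformly_optimal \<Omega> S V s c F \<longleftrightarrow>
    uniform_limit \<Omega> (\<lambda>r \<omega>. best_value S V (c r) \<omega> - V s (c r) \<omega>) (\<lambda>_. 0) F"
proof -
  let ?d = "\<lambda>r \<omega>. \<bar>best_value S V (c r) \<omega> - V s (c r) \<omega>\<bar>"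
  show ?thesis
  proof
    assume "uniformly_optimal \<Omega> S V s c F"
    then have lim: "((\<lambda>r. SUP \<omega>\<in>\<Omega>. ?d r \<omega>) \<longlongrightarrow> 0) F"
      by (simp add: uniformly_optimal_def)
    show "uniform_limit \<Omega> (\<lambda>r \<omega>. best_value S V (c r) \<omega> - V s (c r) \<omega>) (\<lambda>_. 0) F"
    proof (rule uniform_limitI)
      fix e :: real
      assume "0 < e"
      then have "\<forall>\<^sub>F r in F. (SUP \<omega>\<in>\<Omega>. ?d r \<omega>) < e"
        using lim by (intro order_tendstoD(2))
      \<comment> \<open>Boundedness makes the real \<open>SUP\<close> a true supremum, which
        dominates every point.\<close>
      with bdd show "\<forall>\<^sub>F r in F. \<forall>\<omega>\<in>\<Omega>. dist (best_value S V (c r) \<omega> - V s (c r) \<omega>) 0 < e"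
      proof eventually_elim
        case (elim r)
        then show ?case
          using cSUP_upper[OF _ elim(1)] by (fastforce simp: dist_real_def)
      qed
    qed
  next
    assume lim: "uniform_limit \<Omega> (\<lambda>r \<omega>. best_value S V (c r) \<omega> - V s (c r) \<omega>) (\<lambda>_. 0) F"
    have "((\<lambda>r. SUP \<omega>\<in>\<Omega>. ?d r \<omega>) \<longlongrightarrow> 0) F"
    proof (rule tendstoI)
      fix e :: real
      assume e: "0 < e"
      then have "\<forall>\<^sub>F r in F. \<forall>\<omega>\<in>\<Omega>. dist (best_value S V (c r) \<omega> - V s (c r) \<omega>) 0 < e / 2"
        using uniform_limitD[OF lim, of "e / 2"] by simp
      with bdd show "\<forall>\<^sub>F r in F. dist (SUP \<omega>\<in>\<Omega>. ?d r \<omega>) 0 < e"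
      proof eventually_elim
        case (elim r)
        \<comment> \<open>A strict pointwise bound survives in the supremum only as a weak one,
          hence the margin e / 2.\<close>
        have "(SUP \<omega>\<in>\<Omega>. ?d r \<omega>) \<le> e / 2"
          using elim ne by (intro cSUP_least) (auto simp: dist_real_def)
        moreover obtain \<omega> where "\<omega> \<in> \<Omega>"
          using ne by blast
        then have "0 \<le> (SUP \<omega>\<in>\<Omega>. ?d r \<omega>)"
          using cSUP_upper[OF _ elim(1), of \<omega>] by (auto intro: order_trans[rotated])
        ultimately show ?case
          using e by (simp add: dist_real_def)
      qed
    qed
    then show "uniformly_optimal \<Omega> S V s c F"
      by (simp add: uniformly_optimal_def)
  qed
qed

lemma bounded_maps_diff_bdd_above:
  assumes "f \<in> bounded_maps \<Omega>" "f' \<in> bounded_maps \<Omega>"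
  shows "bdd_above ((\<lambda>\<omega>. \<bar>f \<omega> - f' \<omega>\<bar>) ` \<Omega>)"
proof -
  obtain b b' where "\<And>\<omega>. \<omega> \<in> \<Omega> \<Longrightarrow> \<bar>f \<omega>\<bar> \<le> b" "\<And>\<omega>. \<omega> \<in> \<Omega> \<Longrightarrow> \<bar>f' \<omega>\<bar> \<le> b'"
    using assms by (auto simp: bounded_maps_def bounded_iff)
  then show ?thesis
    by (intro bdd_aboveI[of _ "b + b'"]) (fastforce intro: abs_triangle_ineq4 order_trans add_mono)
qed

theorem theorem2:
  fixes \<Omega> :: "'w set"
    and K :: "(real \<Rightarrow> 'w) set"
    and g :: "'w \<Rightarrow> real"
    and C :: "((real \<Rightarrow> 'w) \<Rightarrow> real) set"
    and S :: "'s set"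
    and V :: "'s \<Rightarrow> ((real \<Rightarrow> 'w) \<Rightarrow> real) \<Rightarrow> 'w \<Rightarrow> real"
    and s0 :: 's
  defines "v \<equiv> avg_payoff K g"
    and "w \<equiv> disc_payoff K g"
    and "Vbest \<equiv> best_value S V"
  assumes "payoff_system \<Omega> K g C"
    and "\<And>s. s \<in> S \<Longrightarrow> game_value_map \<Omega> K C (V s)"
    and "\<And>c \<omega>. c \<in> C \<Longrightarrow> \<omega> \<in> \<Omega> \<Longrightarrow> bdd_above ((\<lambda>s. V s c \<omega>) ` S)"
    and "game_value_map \<Omega> K C Vbest"
    and "s0 \<in> S"
    and "avg_weak_dpp \<Omega> K g C (V s0)"
    and "disc_weak_dpp \<Omega> K g C (V s0)"
    and "avg_weak_dpp \<Omega> K g C Vbest"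
    and "disc_weak_dpp \<Omega> K g C Vbest"
  defines "cond_v \<equiv> uniformly_optimal \<Omega> S V s0 v at_top \<and>
                    (\<exists>l. uniform_limit \<Omega> (\<lambda>T. Vbest (v T)) l at_top)"
    and "cond_w \<equiv> uniformly_optimal \<Omega> S V s0 w (at_right 0) \<and>
                    (\<exists>l. uniform_limit \<Omega> (\<lambda>r. Vbest (w r)) l (at_right 0))"
    and "cond_eq \<equiv> \<exists>l. uniform_limit \<Omega> (\<lambda>T. Vbest (v T)) l at_top \<and>
                        uniform_limit \<Omega> (\<lambda>r. Vbest (w r)) l (at_right 0) \<and>
                        uniform_limit \<Omega> (\<lambda>T. V s0 (v T)) l at_top \<and>
                        uniform_limit \<Omega> (\<lambda>r. V s0 (w r)) l (at_right 0)"
  shows "(cond_v \<longleftrightarrow> cond_w) \<and> (cond_w \<longleftrightarrow> cond_eq)"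
proof -
  interpret payoff_system \<Omega> K g C by fact
  interpret s: dpp_value \<Omega> K g C "V s0"
    using assms by unfold_locales auto
  interpret best: dpp_value \<Omega> K g C Vbest
    using assms by unfold_locales auto
  have bdd: "bdd_above ((\<lambda>\<omega>. \<bar>best_value S V c \<omega> - V s0 c \<omega>\<bar>) ` \<Omega>)" if "c \<in> C" for c
    using that s.value_map best.value_map
    by (intro bounded_maps_diff_bdd_above) (auto simp: game_value_map_def Vbest_def)
  have opt_v: "uniformly_optimal \<Omega> S V s0 v at_top \<longleftrightarrow>
      uniform_limit \<Omega> (\<lambda>T \<omega>. Vbest (v T) \<omega> - V s0 (v T) \<omega>) (\<lambda>_. 0) at_top"
    unfolding Vbest_def v_def
    by (intro uniformly_optimal_iff Omega_nonempty eventually_mono[OF eventually_gt_at_top[of 0]]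
        bdd avg_payoff_mem)
  have opt_w: "uniformly_optimal \<Omega> S V s0 w (at_right 0) \<longleftrightarrow>
      uniform_limit \<Omega> (\<lambda>r \<omega>. Vbest (w r) \<omega> - V s0 (w r) \<omega>) (\<lambda>_. 0) (at_right 0)"
    unfolding Vbest_def w_def
    by (intro uniformly_optimal_iff Omega_nonempty eventually_mono[OF eventually_at_right_less[of 0]]
        bdd disc_payoff_mem)
  \<comment> \<open>Optimality together with convergence of the best value says that both values
    have a common uniform limit.\<close>
  have same_limit: "uniform_limit \<Omega> (\<lambda>r \<omega>. f r \<omega> - f' r \<omega>) (\<lambda>_. 0) F \<and> (\<exists>l. uniform_limit \<Omega> f l F) \<longleftrightarrow>
      (\<exists>l. uniform_limit \<Omega> f l F \<and> uniform_limit \<Omega> f' l F)" (is "?L \<longleftrightarrow> ?R")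
    for f f' :: "real \<Rightarrow> 'w \<Rightarrow> real" and F
  proof
    assume ?L
    then obtain l where l: "uniform_limit \<Omega> f l F"
      and diff: "uniform_limit \<Omega> (\<lambda>r \<omega>. f r \<omega> - f' r \<omega>) (\<lambda>_. 0) F"
      by blast
    have "uniform_limit \<Omega> f' l F"
      using uniform_limit_minus[OF l diff] by simp
    with l show ?R
      by blast
  next
    assume ?R
    then obtain l where l: "uniform_limit \<Omega> f l F" "uniform_limit \<Omega> f' l F"
      by blast
    have "uniform_limit \<Omega> (\<lambda>r \<omega>. f r \<omega> - f' r \<omega>) (\<lambda>_. 0) F"
      using uniform_limit_minus[OF l] by simp
    with l show ?L
      by blast
  qed
  have "cond_v \<longleftrightarrow> (\<exists>l. uniform_limit \<Omega> (\<lambda>T. Vbest (v T)) l at_top \<and>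
      uniform_limit \<Omega> (\<lambda>T. V s0 (v T)) l at_top)"
    unfolding cond_v_def opt_v by (rule same_limit)
  moreover have "cond_w \<longleftrightarrow> (\<exists>l. uniform_limit \<Omega> (\<lambda>r. Vbest (w r)) l (at_right 0) \<and>
      uniform_limit \<Omega> (\<lambda>r. V s0 (w r)) l (at_right 0))"
    unfolding cond_w_def opt_w by (rule same_limit)
  \<comment> \<open>With the Tauberian theorem for \<open>V s0\<close> and for \<open>Vbest\<close>,
    at the same l, a common limit of the averages, a common limit of the discounted values and a
    common limit of all four become one statement.\<close>
  ultimately show ?thesis
    unfolding cond_eq_def v_def w_def
    by (simp add: s.uniform_limit_avg_iff_disc best.uniform_limit_avg_iff_disc)
qed

end
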